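(* Let $\mathscr{C}\in\mathbb{R}^{n_1\times n_2\times n_3}$ and $\mathscr{D}\in\mathbb{R}^{n_1\times l\times n_3}$ be such that the tensor equation $\mathscr{C}\star\mathscr{X}=\mathscr{D}$ is consistent (has a solution $\mathscr{X}\in\mathbb{R}^{n_2\times l\times n_3}$). Then for any initial tensor $\mathscr{X}_1\in\mathbb{R}^{n_2\times l\times n_3}$, the sequence $\{\mathscr{X}_k\}$ produced by Algorithm B (described in the context) reaches an exact solution of $\mathscr{C}\star\mathscr{X}=\mathscr{D}$ in at most $n_1 l n_3+1$ iteration steps; that is, there is $k\in\{1,\dots,n_1 l n_3+1\}$ such that $\mathscr{X}_k$ is generated and $\mathscr{C}\star\mathscr{X}_k=\mathscr{D}$.
   Context: Third-order tensors: for $\mathscr{A}\in\mathbb{R}^{m\times p\times q}$, $\mathscr{A}^{(k)}=\mathscr{A}(:,:,k)\in\mathbb{R}^{m\times p}$ denotes its $k$-th frontal slice, $k=1,\dots,q$. T-product: for $\mathscr{A}\in\mathbb{R}^{m\times p\times q}$, $\mathscr{B}\in\mathbb{R}^{p\times s\times q}$, $\mathscr{A}\star\mathscr{B}\in\mathbb{R}^{m\times s\times q}$ is defined by $(\mathscr{A}\star\mathscr{B})^{(k)}=\sum_{j=1}^{q}\mathscr{A}^{(k-j+1)}\mathscr{B}^{(j)}$, slice indices of $\mathscr{A}$ taken modulo $q$ in $\{1,\dots,q\}$. Transpose: $\mathscr{A}^T\in\mathbb{R}^{p\times m\times q}$ is obtained by transposing each frontal slice and reversing the order of the transposed slices $2,\dots,q$.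 Inner product: $\langle\mathscr{A},\mathscr{B}\rangle=\sum_{i,j,k}a_{ijk}b_{ijk}=Tr((\mathscr{B}^T\star\mathscr{A})^{(1)})$ with $Tr$ the matrix trace; $\|\mathscr{A}\|=\sqrt{\langle\mathscr{A},\mathscr{A}\rangle}$ is the Frobenius norm. $\mathscr{O}$ is the zero tensor. Algorithm B (exact arithmetic), with input $\mathscr{C},\mathscr{D},\mathscr{X}_1$: set $\mathscr{R}_1=\mathscr{D}-\mathscr{C}\star\mathscr{X}_1$, $\mathscr{P}_1=\mathscr{C}^T\star\mathscr{R}_1$, $\mathscr{Q}_1=\mathscr{P}_1$. For $k=2,3,\dots$: stop if $\mathscr{R}_{k-1}=\mathscr{O}$ or $\mathscr{Q}_{k-1}=\mathscr{O}$; otherwise set $$\mathscr{X}_k=\mathscr{X}_{k-1}+\frac{\|\mathscr{R}_{k-1}\|^2}{\|\mathscr{Q}_{k-1}\|^2}\mathscr{Q}_{k-1},\quad \mathscr{R}_k=\mathscr{D}-\mathscr{C}\star\mathscr{X}_k,\quad \mathscr{P}_k=\mathscr{C}^T\star\mathscr{R}_k,$$ $$\mathscr{Q}_k=\mathscr{P}_k-\frac{Tr((\mathscr{P}_k^T\star\mathscr{Q}_{k-1})^{(1)})}{\|\mathscr{Q}_{k-1}\|^2}\mathscr{Q}_{k-1}.$$ *)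

theory Defs
  imports Complex_Main "Jordan_Normal_Form.Matrix"
begin

text \<open>
  A real third-order tensor of size m x p x q is the list of its q frontal slices, each an
  m x p matrix.  Slices are numbered from 0 here, so that the (k+1)-st frontal slice of A
  is A ! k.
\<close>

type_synonym tensor = "real mat list"

definition tensors :: "nat \<Rightarrow> nat \<Rightarrow> nat \<Rightarrow> tensor set" where
  "tensors m p q = {A. length A = q \<and> set A \<subseteq> carrier_mat m p}"

definition zero_tensor :: "nat \<Rightarrow> nat \<Rightarrow> nat \<Rightarrow> tensor" where
  "zero_tensor m p q = replicate q (0\<^sub>m m p)"

definition tadd :: "tensor \<Rightarrow> tensor \<Rightarrow> tensor" (infixl \<open>\<oplus>\<^sub>t\<close> 65) where
  "A \<oplus>\<^sub>t B = map2 (+) A B"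

definition tdiff :: "tensor \<Rightarrow> tensor \<Rightarrow> tensor" (infixl \<open>\<ominus>\<^sub>t\<close> 65) where
  "A \<ominus>\<^sub>t B = map2 (-) A B"

definition tscale :: "real \<Rightarrow> tensor \<Rightarrow> tensor" (infixr \<open>\<cdot>\<^sub>t\<close> 70) where
  "a \<cdot>\<^sub>t A = map (\<lambda>M. a \<cdot>\<^sub>m M) A"

text \<open>
  With slices numbered from 0, slice k of the T-product is the sum over j < q of the matrix
  products of slice (k - j) mod q of A and slice j of B.  The summand q in the index only
  avoids truncated subtraction.  The sum is written entrywise since matrices of varying
  dimension have no type class zero.
\<close>

definition tprod :: "tensor \<Rightarrow> tensor \<Rightarrow> tensor" (infixl \<open>\<star>\<close> 70) where
  "A \<star> B = (let q = length A in
     map (\<lambda>k. mat (dim_row (A ! k)) (dim_col (B ! k))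
                (\<lambda>(r, c). \<Sum>j<q. (A ! ((k + q - j) mod q) * B ! j) $$ (r, c)))
       [0..<q])"

fun ttranspose :: "tensor \<Rightarrow> tensor" where
  "ttranspose [] = []"
| "ttranspose (M # Ms) = transpose_mat M # rev (map transpose_mat Ms)"

definition mat_trace :: "real mat \<Rightarrow> real" where
  "mat_trace M = (\<Sum>i<dim_row M. M $$ (i, i))"

definition tinner :: "tensor \<Rightarrow> tensor \<Rightarrow> real" where
  "tinner A B =
     (\<Sum>k<length A. \<Sum>i<dim_row (A ! k). \<Sum>j<dim_col (A ! k). A ! k $$ (i, j) * B ! k $$ (i, j))"

definition tnorm :: "tensor \<Rightarrow> real" where
  "tnorm A = sqrt (tinner A A)"

text \<open>
  The proposition algB n1 n2 l n3 C D X1 k X R P Q says that the algorithm, run on C, D, X1,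
  generates its k-th iterates (numbered from 1), and that these are X, R, P, Q.  When the
  stopping criterion holds at step k, no iterates exist for any larger index.
\<close>

inductive algB ::
  "nat \<Rightarrow> nat \<Rightarrow> nat \<Rightarrow> nat \<Rightarrow> tensor \<Rightarrow> tensor \<Rightarrow> tensor \<Rightarrow>
   nat \<Rightarrow> tensor \<Rightarrow> tensor \<Rightarrow> tensor \<Rightarrow> tensor \<Rightarrow> bool"
  for n1 n2 l n3 :: nat and C D X1 :: tensor where
  init:
    "\<lbrakk> R = D \<ominus>\<^sub>t C \<star> X1; P = ttranspose C \<star> R \<rbrakk>
     \<Longrightarrow> algB n1 n2 l n3 C D X1 1 X1 R P P"
| step:
    "\<lbrakk> algB n1 n2 l n3 C D X1 k X R P Q;
       R \<noteq> zero_tensor n1 l n3; Q \<noteq> zero_tensor n2 l n3;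
       X' = X \<oplus>\<^sub>t ((tnorm R)\<^sup>2 / (tnorm Q)\<^sup>2) \<cdot>\<^sub>t Q;
       R' = D \<ominus>\<^sub>t C \<star> X';
       P' = ttranspose C \<star> R';
       Q' = P' \<ominus>\<^sub>t (mat_trace ((ttranspose P' \<star> Q) ! 0) / (tnorm Q)\<^sup>2) \<cdot>\<^sub>t Q \<rbrakk>
     \<Longrightarrow> algB n1 n2 l n3 C D X1 (Suc k) X' R' P' Q'"

end

(* The residuals R k of the iteration are pairwise orthogonal, and so are the directions Q k;
   both follow by the usual simultaneous induction because C^T is the adjoint of C with respect
   to the inner product. Bessel's inequality therefore forces one of the first n1 * l * n3 + 1
   residuals to vanish. The iteration cannot break down earlier with Q k = 0: for a solution Z,
   the inner product of Q k with the error Z - X k is the squared norm of R k. *)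

theory Submission
  imports Defs
begin

section \<open>The inner product space of tensors\<close>

lemma tensorsD:
  assumes "A \<in> tensors m p q"
  shows "length A = q" "\<And>k. k < q \<Longrightarrow> A ! k \<in> carrier_mat m p"
    "\<And>k. k < q \<Longrightarrow> dim_row (A ! k) = m" "\<And>k. k < q \<Longrightarrow> dim_col (A ! k) = p"
proof -
  show len: "length A = q"
    using assms by (simp add: tensors_def)
  show car: "A ! k \<in> carrier_mat m p" if "k < q" for k
    using assms that nth_mem[of k A] len by (auto simp: tensors_def)
  show "dim_row (A ! k) = m" "dim_col (A ! k) = p" if "k < q" for k
    using car[OF that] by auto
qed

lemma tensorsI:
  assumes "length A = q" "\<And>k. k < q \<Longrightarrow> A ! k \<in> carrier_mat m p"
  shows "A \<in> tensors m p q"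
  using assms by (auto simp: tensors_def in_set_conv_nth)

lemma tensor_eqI:
  assumes "A \<in> tensors m p q" "B \<in> tensors m p q"
    and "\<And>k i j. \<lbrakk> k < q; i < m; j < p \<rbrakk> \<Longrightarrow> A ! k $$ (i, j) = B ! k $$ (i, j)"
  shows "A = B"
proof (rule nth_equalityI)
  show "length A = length B"
    using assms(1,2) by (simp add: tensorsD)
  fix k assume "k < length A"
  then have k: "k < q"
    using assms(1) by (simp add: tensorsD)
  show "A ! k = B ! k"
    by (rule eq_matI) (use assms k in \<open>simp_all add: tensorsD\<close>)
qed

lemma zero_tensor_closed: "zero_tensor m p q \<in> tensors m p q"
  by (rule tensorsI) (simp_all add: zero_tensor_def)

lemma tadd_closed:
  assumes "A \<in> tensors m p q" "B \<in> tensors m p q"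
  shows "A \<oplus>\<^sub>t B \<in> tensors m p q"
  by (rule tensorsI) (use assms in \<open>simp_all add: tadd_def tensorsD\<close>)

lemma tdiff_closed:
  assumes "A \<in> tensors m p q" "B \<in> tensors m p q"
  shows "A \<ominus>\<^sub>t B \<in> tensors m p q"
  by (rule tensorsI)
    (use assms in \<open>auto simp: tdiff_def tensorsD intro!: minus_carrier_mat\<close>)

lemma tscale_closed:
  assumes "A \<in> tensors m p q"
  shows "a \<cdot>\<^sub>t A \<in> tensors m p q"
  by (rule tensorsI) (use assms in \<open>simp_all add: tscale_def tensorsD\<close>)

lemma nth_zero_tensor:
  assumes "k < q" "i < m" "j < p"
  shows "zero_tensor m p q ! k $$ (i, j) = 0"
  using assms by (simp add: zero_tensor_def)

lemma nth_tadd: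
  assumes "A \<in> tensors m p q" "B \<in> tensors m p q" "k < q" "i < m" "j < p"
  shows "(A \<oplus>\<^sub>t B) ! k $$ (i, j) = A ! k $$ (i, j) + B ! k $$ (i, j)"
  using assms by (simp add: tadd_def tensorsD)

lemma nth_tdiff:
  assumes "A \<in> tensors m p q" "B \<in> tensors m p q" "k < q" "i < m" "j < p"
  shows "(A \<ominus>\<^sub>t B) ! k $$ (i, j) = A ! k $$ (i, j) - B ! k $$ (i, j)"
  using assms by (simp add: tdiff_def tensorsD)

lemma nth_tscale:
  assumes "A \<in> tensors m p q" "k < q" "i < m" "j < p"
  shows "(a \<cdot>\<^sub>t A) ! k $$ (i, j) = a * A ! k $$ (i, j)"
  using assms by (simp add: tscale_def tensorsD)

text \<open>Reading the dimensions as parameters instead of taking them from \<open>A\<close> lets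
  bilinearity and symmetry be checked entrywise.\<close>

lemma tinner_eq_sum:
  assumes "A \<in> tensors m p q"
  shows "tinner A B = (\<Sum>k<q. \<Sum>i<m. \<Sum>j<p. A ! k $$ (i, j) * B ! k $$ (i, j))"
  using assms by (simp add: tinner_def tensorsD)

lemma tinner_commute:
  assumes "A \<in> tensors m p q" "B \<in> tensors m p q"
  shows "tinner A B = tinner B A"
  using assms by (simp add: tinner_eq_sum mult.commute)

lemma tinner_tadd_left:
  assumes "A \<in> tensors m p q" "B \<in> tensors m p q"
  shows "tinner (A \<oplus>\<^sub>t B) E = tinner A E + tinner B E"
  using assms tadd_closed[OF assms]
  by (simp add: tinner_eq_sum nth_tadd distrib_right sum.distrib)

lemma tinner_tdiff_left:
  assumes "A \<in> tensors m p q" "B \<in> tensors m p q"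
  shows "tinner (A \<ominus>\<^sub>t B) E = tinner A E - tinner B E"
  using assms tdiff_closed[OF assms]
  by (simp add: tinner_eq_sum nth_tdiff left_diff_distrib sum_subtractf)

lemma tinner_tscale_left:
  assumes "A \<in> tensors m p q"
  shows "tinner (a \<cdot>\<^sub>t A) E = a * tinner A E"
  unfolding tinner_eq_sum[OF assms] tinner_eq_sum[OF tscale_closed[OF assms]]
  by (simp add: sum_distrib_left mult.assoc nth_tscale[OF assms])

lemma tinner_self_nonneg: "0 \<le> tinner A A"
  unfolding tinner_def by (intro sum_nonneg) simp

lemma tinner_self_eq_0_iff:
  assumes "A \<in> tensors m p q"
  shows "tinner A A = 0 \<longleftrightarrow> A = zero_tensor m p q"
proof
  assume "A = zero_tensor m p q"
  then show "tinner A A = 0"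
    using assms by (simp add: tinner_eq_sum nth_zero_tensor)
next
  assume "tinner A A = 0"
  then have "A ! k $$ (i, j) = 0" if "k < q" "i < m" "j < p" for k i j
    using that assms by (simp add: tinner_eq_sum sum_nonneg_eq_0_iff sum_nonneg)
  then show "A = zero_tensor m p q"
    by (intro tensor_eqI[OF assms zero_tensor_closed]) (simp add: nth_zero_tensor)
qed

lemma tnorm_squared: "(tnorm A)\<^sup>2 = tinner A A"
  by (simp add: tnorm_def tinner_self_nonneg)

section \<open>The T-product and its adjoint\<close>

lemma tprod_closed:
  assumes "A \<in> tensors m p q" "B \<in> tensors p s q"
  shows "A \<star> B \<in> tensors m s q"
  by (rule tensorsI) (use assms in \<open>simp_all add: tprod_def Let_def tensorsD\<close>)

lemma nth_tprod:
  assumes "A \<in> tensors m p q" "B \<in> tensors p s q" "k < q" "i < m" "c < s"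
  shows "(A \<star> B) ! k $$ (i, c) =
    (\<Sum>j<q. \<Sum>a<p. A ! ((k + q - j) mod q) $$ (i, a) * B ! j $$ (a, c))"
proof -
  have "(A \<star> B) ! k $$ (i, c) = (\<Sum>j<q. (A ! ((k + q - j) mod q) * B ! j) $$ (i, c))"
    using assms by (simp add: tprod_def Let_def tensorsD)
  also have "\<dots> = (\<Sum>j<q. \<Sum>a<p. A ! ((k + q - j) mod q) $$ (i, a) * B ! j $$ (a, c))"
    using assms by (intro sum.cong refl)
      (simp add: tensorsD scalar_prod_def atLeast0LessThan)
  finally show ?thesis .
qed

lemma tprod_tadd:
  assumes "A \<in> tensors m p q" "B \<in> tensors p s q" "E \<in> tensors p s q"
  shows "A \<star> (B \<oplus>\<^sub>t E) = A \<star> B \<oplus>\<^sub>t A \<star> E"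
  using assms
  by (intro tensor_eqI[of _ m s q])
    (simp_all add: tadd_closed tprod_closed[of _ m p q _ s] nth_tadd[of _ m s q] nth_tadd[of _ p s q]
      nth_tprod[of _ m p q _ s] distrib_left sum.distrib)

lemma tprod_tdiff:
  assumes "A \<in> tensors m p q" "B \<in> tensors p s q" "E \<in> tensors p s q"
  shows "A \<star> (B \<ominus>\<^sub>t E) = A \<star> B \<ominus>\<^sub>t A \<star> E"
  using assms
  by (intro tensor_eqI[of _ m s q])
    (simp_all add: tdiff_closed tprod_closed[of _ m p q _ s] nth_tdiff[of _ m s q] nth_tdiff[of _ p s q]
      nth_tprod[of _ m p q _ s] right_diff_distrib sum_subtractf)

lemma tprod_tscale:
  assumes "A \<in> tensors m p q" "B \<in> tensors p s q"
  shows "A \<star> (a \<cdot>\<^sub>t B) = a \<cdot>\<^sub>t (A \<star> B)"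
  using assms
  by (intro tensor_eqI[of _ m s q])
    (simp_all add: tscale_closed tprod_closed[of _ m p q _ s] nth_tscale[of _ m s q]
      nth_tscale[of _ p s q] nth_tprod[of _ m p q _ s] sum_distrib_left mult.left_commute)

section \<open>Transposition and the adjoint identity\<close>

lemma length_ttranspose: "length (ttranspose A) = length A"
  by (cases A) auto

text \<open>Keeping slice 0 and reversing the others negates the slice index modulo the length; the
  outer \<open>mod\<close> sends \<open>k = 0\<close> back to 0.\<close>

lemma nth_ttranspose:
  assumes "k < length A"
  shows "ttranspose A ! k = transpose_mat (A ! ((length A - k) mod length A))"
proof (cases A)
  case Nil
  with assms show ?thesis by simp
next
  case (Cons M Ms)
  show ?thesis
  proof (cases k)
    case 0
    with Cons show ?thesis by simp
  next
    case (Suc k')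
    then have "(length A - k) mod length A = Suc (length Ms - Suc k')"
      using Cons assms by simp
    with Suc Cons assms show ?thesis
      by (simp add: rev_nth)
  qed
qed

lemma ttranspose_closed:
  assumes "A \<in> tensors m p q"
  shows "ttranspose A \<in> tensors p m q"
  by (rule tensorsI) (use assms in \<open>simp_all add: length_ttranspose nth_ttranspose tensorsD\<close>)

lemma nth_ttranspose_entry:
  assumes "A \<in> tensors m p q" "k < q" "i < p" "j < m"
  shows "ttranspose A ! k $$ (i, j) = A ! ((q - k) mod q) $$ (j, i)"
  using assms by (simp add: nth_ttranspose tensorsD)

text \<open>Modulo \<open>q\<close> this is -(k - t) = t - k. It combines the index negation of the
  transpose with the index difference in the T-product.\<close>

lemma cyclic_index_reflect:
  fixes k t q :: nat
  assumes "k < q" "t < q"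
  shows "(q - (k + q - t) mod q) mod q = (t + q - k) mod q"
proof (cases "t \<le> k")
  case True
  then have "(k + q - t) mod q = (k - t + q) mod q" by simp
  then have "(k + q - t) mod q = k - t"
    using assms unfolding mod_add_self2 by simp
  then show ?thesis using True assms by (simp add: add.commute)
next
  case False
  then have "(t + q - k) mod q = (t - k + q) mod q" by simp
  then have "(t + q - k) mod q = t - k"
    using assms unfolding mod_add_self2 by simp
  then show ?thesis using False assms by simp
qed

text \<open>Both sides expand to the same fivefold sum: by index negation, the transpose uses slice
  t - k of \<open>C\<close>, exactly the slice through which \<open>C\<close> carries slice k of
  \<open>Q\<close> to slice t.\<close>

lemma tinner_tprod_adjoint:
  assumes C: "C \<in> tensors m p q" and R: "R \<in> tensors m s q" and Q: "Q \<in> tensors p s q"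
  shows "tinner (ttranspose C \<star> R) Q = tinner R (C \<star> Q)"
proof -
  let ?f = "\<lambda>k i j t a. C ! ((t + q - k) mod q) $$ (a, i) * R ! t $$ (a, j) * Q ! k $$ (i, j)"
  have "tinner (ttranspose C \<star> R) Q = (\<Sum>k<q. \<Sum>i<p. \<Sum>j<s. \<Sum>t<q. \<Sum>a<m. ?f k i j t a)"
    using tprod_closed[OF ttranspose_closed[OF C] R]
    by (simp add: tinner_eq_sum nth_tprod[OF ttranspose_closed[OF C] R] sum_distrib_right
        nth_ttranspose_entry[OF C] cyclic_index_reflect)
  also have "\<dots> = (\<Sum>(k, i, j, t, a) \<in> {..<q} \<times> {..<p} \<times> {..<s} \<times> {..<q} \<times> {..<m}. ?f k i j t a)"
    by (simp add: sum.cartesian_product)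
  also have "\<dots> = (\<Sum>(t, a, j, k, i) \<in> {..<q} \<times> {..<m} \<times> {..<s} \<times> {..<q} \<times> {..<p}. ?f k i j t a)"
    by (rule sum.reindex_bij_witness[where
          i = "\<lambda>(t, a, j, k, i). (k, i, j, t, a)" and j = "\<lambda>(k, i, j, t, a). (t, a, j, k, i)"])
      auto
  also have "\<dots> = (\<Sum>t<q. \<Sum>a<m. \<Sum>j<s. \<Sum>k<q. \<Sum>i<p. ?f k i j t a)"
    by (simp add: sum.cartesian_product)
  also have "\<dots> = tinner R (C \<star> Q)"
    using R by (simp add: tinner_eq_sum nth_tprod[OF C Q] sum_distrib_left mult_ac)
  finally show ?thesis .
qed

text \<open>In slice 0 of the product, slice k of \<open>Q\<close> meets slice -k of the transpose,
  which is the transposed slice k of \<open>P\<close>. The trace then sums products of matching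
  entries.\<close>

lemma mat_trace_ttranspose_tprod:
  assumes P: "P \<in> tensors m p q" and Q: "Q \<in> tensors m p q" and "0 < q"
  shows "mat_trace ((ttranspose P \<star> Q) ! 0) = tinner P Q"
proof -
  have PQ: "(ttranspose P \<star> Q) \<in> tensors p p q"
    by (rule tprod_closed[OF ttranspose_closed[OF P] Q])
  have "mat_trace ((ttranspose P \<star> Q) ! 0) =
      (\<Sum>c<p. \<Sum>k<q. \<Sum>a<m. P ! k $$ (a, c) * Q ! k $$ (a, c))"
    using \<open>0 < q\<close> cyclic_index_reflect[of 0 q]
    by (simp add: mat_trace_def tensorsD[OF PQ] nth_tprod[OF ttranspose_closed[OF P] Q]
        nth_ttranspose_entry[OF P])
  also have "\<dots> = (\<Sum>k<q. \<Sum>c<p. \<Sum>a<m. P ! k $$ (a, c) * Q ! k $$ (a, c))"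
    by (rule sum.swap)
  also have "\<dots> = tinner P Q"
    unfolding tinner_eq_sum[OF P] by (intro sum.cong refl sum.swap)
  finally show ?thesis .
qed

section \<open>Orthogonal families\<close>

text \<open>Summing Bessel's inequality for the unit vector at \<open>e\<close> over all \<open>e \<in> I\<close> bounds
  \<open>card K\<close>.\<close>

lemma card_orthogonal_le:
  fixes f :: "'k \<Rightarrow> 'i \<Rightarrow> real"
  assumes fin: "finite I" "finite K"
    and nz: "\<And>k. k \<in> K \<Longrightarrow> (\<Sum>i\<in>I. f k i * f k i) \<noteq> 0"
    and orth: "\<And>k k'. \<lbrakk> k \<in> K; k' \<in> K; k \<noteq> k' \<rbrakk> \<Longrightarrow> (\<Sum>i\<in>I. f k i * f k' i) = 0"
  shows "card K \<le> card I"
proof -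
  define n where "n k = (\<Sum>i\<in>I. f k i * f k i)" for k
  have bessel: "(\<Sum>k\<in>K. f k e * f k e / n k) \<le> 1" if e: "e \<in> I" for e
  proof -
    \<comment> \<open>\<open>d\<close> is the unit vector at \<open>e\<close>, and \<open>g\<close>
      its projection onto the span of the orthogonal family.\<close>
    define d where "d i = (if i = e then 1 else 0 :: real)" for i
    define g where "g i = (\<Sum>k\<in>K. f k e / n k * f k i)" for i
    let ?s = "\<Sum>k\<in>K. f k e * f k e / n k"
    have fg: "(\<Sum>i\<in>I. f k i * g i) = f k e" if k: "k \<in> K" for k
    proof -
      have "(\<Sum>i\<in>I. f k i * g i) = (\<Sum>k'\<in>K. f k' e / n k' * (\<Sum>i\<in>I. f k i * f k' i))"
        unfolding g_def sum_distrib_left by (subst sum.swap) (simp add: mult_ac)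
      also have "\<dots> = (\<Sum>k'\<in>K. if k' = k then f k e else 0)"
        by (rule sum.cong) (use k orth nz in \<open>auto simp: n_def\<close>)
      finally show ?thesis using fin k by simp
    qed
    have "(\<Sum>i\<in>I. g i * g i) = (\<Sum>k\<in>K. f k e / n k * (\<Sum>i\<in>I. f k i * g i))"
      unfolding sum_distrib_left by (subst sum.swap) (simp add: g_def sum_distrib_right mult_ac)
    also have "\<dots> = ?s"
      by (simp add: fg)
    finally have gg: "(\<Sum>i\<in>I. g i * g i) = ?s" .
    have dg: "(\<Sum>i\<in>I. d i * g i) = g e" and dd: "(\<Sum>i\<in>I. d i * d i) = 1"
      using fin e by (simp_all add: d_def if_distrib[of "\<lambda>x. x * _"] cong: if_cong)
    \<comment> \<open>The squared distance from \<open>d\<close> to its projection is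
      \<open>1 - ?s\<close>, because \<open>d\<close> and \<open>g\<close> both have inner product
      \<open>?s\<close> with \<open>g\<close>.\<close>
    have "0 \<le> (\<Sum>i\<in>I. (d i - g i)\<^sup>2)"
      by (intro sum_nonneg) simp
    also have "\<dots> = (\<Sum>i\<in>I. d i * d i) - 2 * (\<Sum>i\<in>I. d i * g i) + (\<Sum>i\<in>I. g i * g i)"
      by (simp add: power2_eq_square algebra_simps sum.distrib sum_subtractf sum_distrib_left)
    also have "\<dots> = 1 - ?s"
      unfolding dg dd gg by (simp add: g_def)
    finally show ?thesis by simp
  qed
  \<comment> \<open>Each \<open>k\<close> contributes \<open>n k / n k = 1\<close>; exchanging the
    sums leaves one Bessel bound for each \<open>e\<close>.\<close>
  have "real (card K) = (\<Sum>k\<in>K. (\<Sum>e\<in>I. f k e * f k e) / n k)"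
    using nz by (simp add: n_def)
  also have "\<dots> = (\<Sum>e\<in>I. \<Sum>k\<in>K. f k e * f k e / n k)"
    by (simp add: sum_divide_distrib sum.swap[of _ I K])
  also have "\<dots> \<le> real (card I)"
    using sum_mono[of I _ "\<lambda>_. 1", OF bessel] by simp
  finally show ?thesis by simp
qed

text \<open>Flattening a tensor to a function on its \<open>m * p * q\<close> index triples turns
  \<open>tinner\<close> into the sum of \<open>card_orthogonal_le\<close>.\<close>

lemma card_orthogonal_tensors_le:
  assumes "finite K" and U: "\<And>k. k \<in> K \<Longrightarrow> U k \<in> tensors m p q"
    and nz: "\<And>k. k \<in> K \<Longrightarrow> U k \<noteq> zero_tensor m p q"
    and orth: "\<And>k k'. \<lbrakk> k \<in> K; k' \<in> K; k \<noteq> k' \<rbrakk> \<Longrightarrow> tinner (U k) (U k') = 0"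
  shows "card K \<le> m * p * q"
proof -
  let ?I = "{..<q} \<times> {..<m} \<times> {..<p}"
  define f where "f k = (\<lambda>(t, i, j). U k ! t $$ (i, j))" for k
  have *: "(\<Sum>x\<in>?I. f k x * f k' x) = tinner (U k) (U k')" if "k \<in> K" for k k'
    using U[OF that] by (simp add: tinner_eq_sum sum.cartesian_product f_def case_prod_unfold)
  have "card K \<le> card ?I"
    by (rule card_orthogonal_le[of _ _ f])
      (use assms in \<open>auto simp: * tinner_self_eq_0_iff[OF U]\<close>)
  then show ?thesis by (simp add: mult_ac)
qed

section \<open>The conjugate gradient iteration\<close>

text \<open>The recursion is run past the stopping criterion; division by zero makes the extra
  steps harmless.\<close>

locale cg_iteration =
  fixes n1 n2 l n3 :: nat and C D Z :: tensor and X R P Q :: "nat \<Rightarrow> tensor"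
  assumes C: "C \<in> tensors n1 n2 n3" and D: "D \<in> tensors n1 l n3"
    and Z: "Z \<in> tensors n2 l n3" and CZ: "C \<star> Z = D"
    and X0: "X 0 \<in> tensors n2 l n3"
    and R_eq: "R k = D \<ominus>\<^sub>t C \<star> X k"
    and P_eq: "P k = ttranspose C \<star> R k"
    and Q_0: "Q 0 = P 0"
    and X_Suc: "X (Suc k) = X k \<oplus>\<^sub>t (tinner (R k) (R k) / tinner (Q k) (Q k)) \<cdot>\<^sub>t Q k"
    and Q_Suc: "Q (Suc k) =
      P (Suc k) \<ominus>\<^sub>t (tinner (P (Suc k)) (Q k) / tinner (Q k) (Q k)) \<cdot>\<^sub>t Q k"
begin

section \<open>Closure and one-step identities\<close>

lemma X_closed_imp:
  assumes "X k \<in> tensors n2 l n3"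
  shows "R k \<in> tensors n1 l n3" "P k \<in> tensors n2 l n3"
  using assms C D ttranspose_closed[OF C]
  by (auto simp: R_eq P_eq intro!: tdiff_closed tprod_closed)

text \<open>A joint induction: \<open>X (Suc k)\<close> is built from \<open>Q k\<close>, and
  \<open>Q (Suc k)\<close> from \<open>P (Suc k)\<close>, hence from
  \<open>X (Suc k)\<close>.\<close>

lemma XQ_closed: "X k \<in> tensors n2 l n3 \<and> Q k \<in> tensors n2 l n3"
proof (induction k)
  case 0
  then show ?case using X0 X_closed_imp(2)[OF X0] by (simp add: Q_0)
next
  case (Suc k)
  then have X: "X (Suc k) \<in> tensors n2 l n3"
    by (simp add: X_Suc tadd_closed tscale_closed)
  with Suc X_closed_imp(2)[OF X] show ?case
    by (simp add: Q_Suc tdiff_closed tscale_closed)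
qed

lemmas X_closed = XQ_closed[THEN conjunct1]
lemmas Q_closed = XQ_closed[THEN conjunct2]
lemmas R_closed = X_closed_imp(1)[OF X_closed]
lemmas P_closed = X_closed_imp(2)[OF X_closed]

lemma tinner_P:
  assumes "W \<in> tensors n2 l n3"
  shows "tinner (P k) W = tinner (R k) (C \<star> W)"
  unfolding P_eq by (rule tinner_tprod_adjoint[OF C R_closed assms])

lemma R_eq_residual: "R k = C \<star> (Z \<ominus>\<^sub>t X k)"
  by (simp add: tprod_tdiff[OF C Z X_closed] CZ R_eq)

text \<open>By linearity the residual changes by a multiple of the image of \<open>Q k\<close> under
  \<open>C\<close>. The recurrence is paired with \<open>W\<close> because only inner products are
  used later.\<close>

lemma tinner_R_Suc:
  assumes "W \<in> tensors n1 l n3"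
  shows "tinner (R (Suc k)) W =
    tinner (R k) W - tinner (R k) (R k) / tinner (Q k) (Q k) * tinner (C \<star> Q k) W"
proof -
  let ?a = "tinner (R k) (R k) / tinner (Q k) (Q k)"
  have CX: "C \<star> X k \<in> tensors n1 l n3" and CQ: "C \<star> Q k \<in> tensors n1 l n3"
    using C X_closed Q_closed by (auto intro: tprod_closed)
  have "C \<star> X (Suc k) = C \<star> X k \<oplus>\<^sub>t ?a \<cdot>\<^sub>t (C \<star> Q k)"
    unfolding X_Suc
    by (simp add: tprod_tadd[OF C X_closed tscale_closed[OF Q_closed]] tprod_tscale[OF C Q_closed])
  then show ?thesis
    unfolding R_eq[of "Suc k"]
    using D CX CQ
    by (simp add: R_eq[of k] tinner_tdiff_left[of _ n1 l n3] tinner_tadd_left[of _ n1 l n3]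
        tinner_tscale_left[of _ n1 l n3] tadd_closed tscale_closed)
qed

lemma tinner_Q_Suc:
  "tinner (Q (Suc k)) W = tinner (P (Suc k)) W
    - tinner (P (Suc k)) (Q k) / tinner (Q k) (Q k) * tinner (Q k) W"
  unfolding Q_Suc
  by (simp add: tinner_tdiff_left[OF P_closed tscale_closed[OF Q_closed]]
      tinner_tscale_left[OF Q_closed])

text \<open>The step length makes \<open>Q k\<close> orthogonal to the next error, so the correction
  along \<open>Q k\<close> in \<open>Q (Suc k)\<close> contributes nothing. What remains is the
  inner product of \<open>P (Suc k)\<close> with the error, and the adjoint identity turns it into
  the squared norm of the residual.\<close>

lemma tinner_Q_error:
  assumes "\<And>i. i < k \<Longrightarrow> Q i \<noteq> zero_tensor n2 l n3"
  shows "tinner (Q k) (Z \<ominus>\<^sub>t X k) = tinner (R k) (R k)"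
  using assms
proof (induction k)
  case 0
  show ?case
    by (simp add: Q_0 tinner_P[OF tdiff_closed[OF Z X_closed]] flip: R_eq_residual)
next
  case (Suc k)
  have Z_X: "Z \<ominus>\<^sub>t X i \<in> tensors n2 l n3" for i
    by (rule tdiff_closed[OF Z X_closed])
  have QQ: "tinner (Q k) (Q k) \<noteq> 0"
    using Suc.prems[of k] by (simp add: tinner_self_eq_0_iff[OF Q_closed])
  have "tinner (Q k) (Z \<ominus>\<^sub>t X (Suc k)) = tinner (Q k) (Z \<ominus>\<^sub>t X k) -
      tinner (R k) (R k) / tinner (Q k) (Q k) * tinner (Q k) (Q k)"
    unfolding X_Suc
    using Z X_closed Q_closed
    by (simp add: tinner_commute[OF Q_closed Z_X] tinner_commute[OF Q_closed, of "_ \<ominus>\<^sub>t (_ \<oplus>\<^sub>t _)"]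
       tdiff_closed tadd_closed tscale_closed tinner_tdiff_left[of _ n2 l n3]
       tinner_tadd_left[of _ n2 l n3] tinner_tscale_left[of _ n2 l n3])
  also have "\<dots> = 0"
    using Suc QQ by simp
  finally show ?case
    by (simp add: tinner_Q_Suc tinner_P[OF Z_X] flip: R_eq_residual)
qed

text \<open>Strong induction supplies the nonzero earlier directions that
  \<open>tinner_Q_error\<close> requires.\<close>

lemma Q_nonzero:
  assumes "\<And>i. i \<le> k \<Longrightarrow> R i \<noteq> zero_tensor n1 l n3"
  shows "Q k \<noteq> zero_tensor n2 l n3"
  using assms
proof (induction k rule: less_induct)
  case (less k)
  have "tinner (Q k) (Z \<ominus>\<^sub>t X k) = tinner (R k) (R k)"
    by (rule tinner_Q_error) (use less in auto)
  moreover have "tinner (R k) (R k) \<noteq> 0"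
    using less.prems[of k] by (simp add: tinner_self_eq_0_iff[OF R_closed])
  moreover have "tinner (zero_tensor n2 l n3) W = 0" for W
    by (simp add: tinner_eq_sum[OF zero_tensor_closed] nth_zero_tensor)
  ultimately show ?case by auto
qed

lemma orthogonal:
  assumes "\<And>i. i < k \<Longrightarrow> R i \<noteq> zero_tensor n1 l n3"
  shows "\<forall>j<k. tinner (R k) (R j) = 0 \<and> tinner (Q k) (Q j) = 0"
  using assms
proof (induction k rule: less_induct)
  case (less k)
  show ?case
  proof (cases k)
    case 0
    then show ?thesis by simp
  next
    case (Suc n)
    have RR: "tinner (R i) (R i) \<noteq> 0" if "i \<le> n" for i
      using less.prems[of i] that Suc by (simp add: tinner_self_eq_0_iff[OF R_closed])
    have QQ: "tinner (Q i) (Q i) \<noteq> 0" if "i \<le> n" for i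
      using Q_nonzero[of i] less.prems that Suc by (simp add: tinner_self_eq_0_iff[OF Q_closed])
    have IH: "tinner (R i) (R j) = 0" "tinner (Q i) (Q j) = 0" if "j < i" "i \<le> n" for i j
      using less.IH[of i] less.prems that Suc by auto
    have CQ: "C \<star> Q i \<in> tensors n1 l n3" for i
      by (rule tprod_closed[OF C Q_closed])
    \<comment> \<open>\<open>P j\<close> differs from \<open>Q j\<close> by a multiple of the
      preceding direction, which has index below n and so is orthogonal to
      \<open>Q n\<close>.\<close>
    have P_Q: "tinner (P j) (Q n) = tinner (Q j) (Q n)" if "j \<le> n" for j
    proof (cases j)
      case 0
      then show ?thesis by (simp add: Q_0)
    next
      case (Suc i)
      then have "tinner (Q i) (Q n) = 0"
        using that IH(2)[of i n] by (simp add: tinner_commute[OF Q_closed Q_closed])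
      with Suc show ?thesis by (simp add: tinner_Q_Suc)
    qed
    have R_orth: "tinner (R k) (R j) = 0" if "j \<le> n" for j
    proof -
      have "tinner (C \<star> Q n) (R j) = tinner (Q j) (Q n)"
        using P_Q[OF that] tinner_P[OF Q_closed, of j n]
        by (simp add: tinner_commute[OF CQ R_closed])
      then have "tinner (R k) (R j) = tinner (R n) (R j) -
          tinner (R n) (R n) / tinner (Q n) (Q n) * tinner (Q j) (Q n)"
        unfolding Suc by (simp add: tinner_R_Suc[OF R_closed])
      \<comment> \<open>For \<open>j < n\<close> both terms vanish by induction; for
        \<open>j = n\<close> the step length makes them cancel.\<close>
      also have "\<dots> = 0"
        using that IH[of j n] QQ[of n]
        by (cases "j = n") (auto simp: tinner_commute[OF Q_closed Q_closed, of j])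
      finally show ?thesis .
    qed
    have Q_orth: "tinner (Q k) (Q j) = 0" if "j \<le> n" for j
    proof (cases "j = n")
      case True
      then show ?thesis
        \<comment> \<open>The coefficient in \<open>Q_Suc\<close> is the Gram-Schmidt coefficient
          against \<open>Q n\<close>.\<close>
        unfolding Suc using QQ[of n] by (simp add: tinner_Q_Suc)
    next
      case False
      \<comment> \<open>Now \<open>R_orth\<close> applies to both \<open>j\<close> and
        \<open>Suc j\<close>. The difference of these residuals is a nonzero multiple of the image
        of \<open>Q j\<close> under \<open>C\<close>, so this image is orthogonal to
        \<open>R k\<close>.\<close>
      with that have j: "Suc j \<le> n" "j < n" by auto
      have "tinner (R j) (R k) = 0" "tinner (R (Suc j)) (R k) = 0"
        using R_orth[of j] R_orth[of "Suc j"] that j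
        by (simp_all add: tinner_commute[OF R_closed R_closed, of _ k])
      then have "tinner (C \<star> Q j) (R k) = 0"
        using tinner_R_Suc[OF R_closed, of j k] RR[OF that] QQ[OF that] by simp
      then have "tinner (P k) (Q j) = 0"
        by (simp add: tinner_P[OF Q_closed] tinner_commute[OF R_closed CQ])
      then show ?thesis
        unfolding Suc using IH(2)[of j n] j by (simp add: tinner_Q_Suc)
    qed
    show ?thesis
      using R_orth Q_orth Suc by auto
  qed
qed

lemma residual_vanishes: "\<exists>k \<le> n1 * l * n3. R k = zero_tensor n1 l n3"
proof (rule ccontr)
  assume "\<not> ?thesis"
  then have nz: "R k \<noteq> zero_tensor n1 l n3" if "k \<le> n1 * l * n3" for k
    using that by blast
  have orth: "tinner (R i) (R j) = 0" if "i \<le> n1 * l * n3" "j < i" for i j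
    using orthogonal[of i] nz that by auto
  \<comment> \<open>Counting from 0, these are \<open>n1 * l * n3 + 1\<close> residuals, one more
    than the dimension of the space.\<close>
  have "card {.. n1 * l * n3} \<le> n1 * l * n3"
  proof (rule card_orthogonal_tensors_le[of _ R])
    fix i j assume "i \<in> {.. n1 * l * n3}" "j \<in> {.. n1 * l * n3}" "i \<noteq> j"
    then show "tinner (R i) (R j) = 0"
      using orth[of i j] orth[of j i] tinner_commute[OF R_closed R_closed, of i j]
      by (cases "j < i") auto
  qed (use R_closed nz in auto)
  then show False by simp
qed

section \<open>From the unstopped recursion to runs of the algorithm\<close>

lemma solves_if_residual_zero:
  assumes "R k = zero_tensor n1 l n3"
  shows "C \<star> X k = D"
proof (rule tensor_eqI[OF _ D])
  show CX: "C \<star> X k \<in> tensors n1 l n3"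
    by (rule tprod_closed[OF C X_closed])
  fix t i j assume "t < n3" "i < n1" "j < l"
  then show "(C \<star> X k) ! t $$ (i, j) = D ! t $$ (i, j)"
    using nth_tdiff[OF D CX, of t i j] assms by (simp add: R_eq nth_zero_tensor)
qed

text \<open>Nonzero residuals up to an index force a nonzero direction there, so the stopping test
  fails and the algorithm follows the recursion. Iterate \<open>k\<close> of the recursion is
  iterate \<open>Suc k\<close> of \<open>algB\<close>; \<open>0 < n3\<close> provides the slice 0
  whose trace is taken.\<close>

lemma algB_iterates:
  assumes "0 < n3" and "\<And>i. i < k \<Longrightarrow> R i \<noteq> zero_tensor n1 l n3"
  shows "algB n1 n2 l n3 C D (X 0) (Suc k) (X k) (R k) (P k) (Q k)"
  using assms(2)
proof (induction k)
  case 0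
  show ?case
    using algB.init[OF R_eq P_eq] by (simp add: Q_0)
next
  case (Suc k)
  show ?case
  proof (rule algB.step[OF _ _ _ _ R_eq P_eq])
    show "algB n1 n2 l n3 C D (X 0) (Suc k) (X k) (R k) (P k) (Q k)"
      using Suc by simp
    show "R k \<noteq> zero_tensor n1 l n3" "Q k \<noteq> zero_tensor n2 l n3"
      using Suc.prems Q_nonzero[of k] by auto
  qed (simp_all add: tnorm_squared mat_trace_ttranspose_tprod[OF P_closed Q_closed \<open>0 < n3\<close>]
      X_Suc Q_Suc)
qed

end

text \<open>A total recursion that yields the sequences for \<open>cg_iteration\<close>. Only
  \<open>X\<close> and \<open>Q\<close> are carried along, since \<open>R\<close> and
  \<open>P\<close> are computed from \<open>X\<close>.\<close>

primrec cg_iter :: "tensor \<Rightarrow> tensor \<Rightarrow> tensor \<Rightarrow> nat \<Rightarrow> tensor \<times> tensor" where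
  "cg_iter C D X1 0 = (X1, ttranspose C \<star> (D \<ominus>\<^sub>t C \<star> X1))"
| "cg_iter C D X1 (Suc k) =
    (let (X, Q) = cg_iter C D X1 k; R = D \<ominus>\<^sub>t C \<star> X;
         X' = X \<oplus>\<^sub>t (tinner R R / tinner Q Q) \<cdot>\<^sub>t Q;
         P' = ttranspose C \<star> (D \<ominus>\<^sub>t C \<star> X')
     in (X', P' \<ominus>\<^sub>t (tinner P' Q / tinner Q Q) \<cdot>\<^sub>t Q))"

theorem theorem4p4:
  fixes n1 n2 l n3 :: nat and C D X1 :: tensor
  assumes "0 < n1" "0 < n2" "0 < l" "0 < n3"
    and "C \<in> tensors n1 n2 n3"
    and "D \<in> tensors n1 l n3"
    and consistent: "\<exists>X \<in> tensors n2 l n3. C \<star> X = D"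
    and "X1 \<in> tensors n2 l n3"
  shows "\<exists>k \<in> {1..n1 * l * n3 + 1}. \<exists>X R P Q.
           algB n1 n2 l n3 C D X1 k X R P Q \<and> X \<in> tensors n2 l n3 \<and> C \<star> X = D"
proof -
  obtain Z where "Z \<in> tensors n2 l n3" "C \<star> Z = D"
    using consistent by blast
  define X where "X k = fst (cg_iter C D X1 k)" for k
  define R where "R k = D \<ominus>\<^sub>t C \<star> X k" for k
  define P where "P k = ttranspose C \<star> R k" for k
  define Q where "Q k = snd (cg_iter C D X1 k)" for k
  have X_0: "X 0 = X1"
    by (simp add: X_def)
  interpret cg_iteration n1 n2 l n3 C D Z X R P Q
    by standard (use assms X_0 \<open>Z \<in> _\<close> \<open>C \<star> Z = D\<close> in
        \<open>simp_all add: X_def R_def P_def Q_def Let_def case_prod_unfold\<close>)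
  let ?zero = "\<lambda>k. R k = zero_tensor n1 l n3"
  \<comment> \<open>At the first vanishing residual all earlier ones are nonzero, so the algorithm
    has not stopped before generating this iterate.\<close>
  define k where "k = (LEAST k. ?zero k)"
  obtain k0 where "k0 \<le> n1 * l * n3" "?zero k0"
    using residual_vanishes by blast
  then have "?zero k" "k \<le> n1 * l * n3"
    unfolding k_def by (auto intro: LeastI Least_le[THEN le_trans])
  have before: "\<not> ?zero i" if "i < k" for i
    using that unfolding k_def by (rule not_less_Least)
  show ?thesis
  proof (intro bexI exI conjI)
    show "algB n1 n2 l n3 C D X1 (Suc k) (X k) (R k) (P k) (Q k)"
      using algB_iterates[of k] \<open>0 < n3\<close> before by (simp add: X_0)
    show "C \<star> X k = D"
      using \<open>?zero k\<close> by (rule solves_if_residual_zero)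
    show "X k \<in> tensors n2 l n3"
      by (rule X_closed)
    \<comment> \<open>The shift from counting at 0 to counting at 1 accounts for the extra step in
      the bound.\<close>
    show "Suc k \<in> {1..n1 * l * n3 + 1}"
      using \<open>k \<le> n1 * l * n3\<close> by simp
  qed
qed

end
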